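(* Let $a\ge 0$ be a real number, and let $G$ be a simple connected graph of order $n\ge 2$ with minimum degree $\delta\le\frac{n-1}{2}$. If $$\lambda_{1}(aD(G)+A(G))<\varphi(a,n,\delta,1),$$ then $G$ has a fractional perfect matching.
   Context: Graphs are finite, simple and undirected. $A(G)$ is the adjacency matrix of $G$, $D(G)$ is the diagonal matrix of vertex degrees, and $\lambda_1(M)$ denotes the largest eigenvalue of a real symmetric matrix $M$. A fractional matching of $G$ is a function $f:E(G)\to[0,1]$ such that for every vertex $v$ the sum of $f(e)$ over all edges $e$ incident with $v$ is at most $1$. It is a fractional perfect matching if $\sum_{e\in E(G)}f(e)=n/2$. For real $a\ge 0$, real $k\in(0,n)$ and an integer $\delta\le\frac{n-k}{2}$, define $\varphi(a,n,\delta,k)=\delta\sqrt{1+\frac{2k}{n-k}}$ if $a=0$; $\varphi(a,n,\delta,k)=\frac{2a\delta n}{n-k}$ if $0<a\le 1$; $\varphi(a,n,\delta,k)=\frac{a\delta(n+k)}{n-k}$ if $a>1$. *)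

theory Defs
  imports "HOL-Analysis.Analysis" "Graph_Theory.Pair_Digraph" "Graph_Theory.Digraph_Component"
begin

text \<open>
  Finite simple undirected graphs are rendered by the locale \<open>pair_graph\<close> of Graph-Theory:
  a finite, loop-free digraph without parallel arcs whose arc relation is symmetric.  Such a graph
  stores an undirected edge as two opposite arcs, so undirected edges are recovered as two-element
  vertex sets; sums over edges must range over these and not over arcs.
\<close>

definition edges :: "'v pair_pre_digraph \<Rightarrow> 'v set set" where
  "edges G = {{u, v} | u v. (u, v) \<in> parcs G}"

definition incident_edges :: "'v pair_pre_digraph \<Rightarrow> 'v \<Rightarrow> 'v set set" where
  "incident_edges G v = {e \<in> edges G. v \<in> e}"

definition vertex_degree :: "'v pair_pre_digraph \<Rightarrow> 'v \<Rightarrow> nat" where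
  "vertex_degree G v = card (incident_edges G v)"

definition min_degree :: "'v pair_pre_digraph \<Rightarrow> nat" where
  "min_degree G = Min (vertex_degree G ` pverts G)"

definition fractional_matching :: "'v pair_pre_digraph \<Rightarrow> ('v set \<Rightarrow> real) \<Rightarrow> bool" where
  "fractional_matching G f \<longleftrightarrow>
     (\<forall>e \<in> edges G. 0 \<le> f e \<and> f e \<le> 1) \<and>
     (\<forall>v \<in> pverts G. (\<Sum>e \<in> incident_edges G v. f e) \<le> 1)"

definition fractional_perfect_matching :: "'v pair_pre_digraph \<Rightarrow> ('v set \<Rightarrow> real) \<Rightarrow> bool" where
  "fractional_perfect_matching G f \<longleftrightarrow>
     fractional_matching G f \<and> (\<Sum>e \<in> edges G. f e) = real (card (pverts G)) / 2"

text \<open>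
  The matrices are indexed by the vertex type, so they are the usual ones only for graphs
  whose vertex set is the whole type.
\<close>

definition adjacency_matrix :: "'v::finite pair_pre_digraph \<Rightarrow> real ^ 'v ^ 'v" where
  "adjacency_matrix G = (\<chi> u v. if (u, v) \<in> parcs G then 1 else 0)"

definition degree_matrix :: "'v::finite pair_pre_digraph \<Rightarrow> real ^ 'v ^ 'v" where
  "degree_matrix G = (\<chi> u v. if u = v then real (vertex_degree G u) else 0)"

definition eigenvalues :: "real ^ 'n ^ 'n \<Rightarrow> real set" where
  "eigenvalues M = {l. \<exists>x. x \<noteq> 0 \<and> M *v x = l *\<^sub>R x}"

text \<open>
  Intended for symmetric \<open>M\<close>, where the set of real eigenvalues is finite and nonempty.
\<close>

definition largest_eigenvalue :: "real ^ 'n ^ 'n \<Rightarrow> real" where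
  "largest_eigenvalue M = Max (eigenvalues M)"

text \<open>
  Meaningful for \<open>a \<ge> 0\<close>, \<open>0 < k < n\<close> and \<open>\<delta> \<le> (n - k) / 2\<close>.
\<close>

definition phi :: "real \<Rightarrow> nat \<Rightarrow> int \<Rightarrow> real \<Rightarrow> real" where
  "phi a n \<delta> k =
     (if a = 0 then of_int \<delta> * sqrt (1 + 2 * k / (real n - k))
      else if a \<le> 1 then 2 * a * of_int \<delta> * real n / (real n - k)
      else a * of_int \<delta> * (real n + k) / (real n - k))"

end

theory Submission
  imports Defs
begin

text \<open>
  A perfect matching of the bipartite double cover, with every arc weighted \<open>1 / 2\<close>, is a
  fractional perfect matching. If there is none, some \<open>X\<close> violates Hall's condition, and
  \<open>T = X - N(X)\<close> is then an independent set with fewer neighbours than elements. With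
  \<open>S = N(T)\<close>, \<open>s = |S|\<close> and \<open>t = |T| \<ge> s + 1\<close>, at least \<open>\<delta> t\<close> edges run between
  \<open>S\<close> and \<open>T\<close>, so the Rayleigh quotient of a vector that is constant on \<open>S\<close>, constant on
  \<open>T\<close> and zero elsewhere bounds the largest eigenvalue from below in terms of \<open>t / s\<close>, and
  \<open>t / s \<ge> (n + 1) / (n - 1)\<close> because \<open>s + t \<le> n\<close>.
\<close>

section \<open>Hall's marriage theorem\<close>

text \<open>
  Rado's argument: if deleting \<open>x\<close> violates Hall's condition at \<open>J\<close> and deleting \<open>y\<close> violates it
  at \<open>K\<close>, submodularity makes the original family violate it at \<open>J \<union> K\<close> or at
  \<open>(J \<inter> K) - {i}\<close>.
\<close>

lemma hall_condition_delete_or: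
  fixes F :: "'i \<Rightarrow> 'b set"
  assumes I: "finite I" and fin: "\<And>i. i \<in> I \<Longrightarrow> finite (F i)"
    and hall: "\<And>J. J \<subseteq> I \<Longrightarrow> card J \<le> card (\<Union>(F ` J))"
    and i: "i \<in> I" and xy: "x \<noteq> y"
    and J: "J \<subseteq> I" "card (\<Union>((F(i := F i - {x})) ` J)) < card J"
  shows "K \<subseteq> I \<Longrightarrow> card K \<le> card (\<Union>((F(i := F i - {y})) ` K))"
proof (rule ccontr)
  assume K: "K \<subseteq> I" and "\<not> card K \<le> card (\<Union>((F(i := F i - {y})) ` K))"
  then have K2: "card (\<Union>((F(i := F i - {y})) ` K)) < card K" by simp
  \<comment> \<open>Only the set at \<open>i\<close> has changed, so a violating set of indices has
    to contain \<open>i\<close>.\<close>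
  have mem: "i \<in> L" if "L \<subseteq> I" "card (\<Union>((F(i := F i - {z})) ` L)) < card L" for L z
  proof (rule ccontr)
    assume "i \<notin> L"
    then have "(F(i := F i - {z})) ` L = F ` L" by (auto simp: image_iff)
    then have "card (\<Union>(F ` L)) < card L" using that(2) by (simp only:)
    with hall[OF that(1)] show False by simp
  qed
  define J' where "J' = J - {i}"
  define K' where "K' = K - {i}"
  have J': "J = insert i J'" "i \<notin> J'" and K': "K = insert i K'" "i \<notin> K'"
    using mem[OF J] mem[OF K K2] by (auto simp: J'_def K'_def)
  have finJ: "finite J" "finite K" using I J K finite_subset by blast+
  then have finJ': "finite J'" "finite K'" by (auto simp: J'_def K'_def)
  have sub: "J' \<subseteq> I" "K' \<subseteq> I" using J K by (auto simp: J'_def K'_def)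
  define A where "A = \<Union>(F ` J') \<union> (F i - {x})"
  define B where "B = \<Union>(F ` K') \<union> (F i - {y})"
  have eqA: "\<Union>((F(i := F i - {x})) ` J) = A"
    unfolding A_def J'(1) using J'(2) by (auto split: if_splits)
  have eqB: "\<Union>((F(i := F i - {y})) ` K) = B"
    unfolding B_def K'(1) using K'(2) by (auto split: if_splits)
  have cA: "card A \<le> card J'" using J eqA J' finJ' by simp
  have cB: "card B \<le> card K'" using K2 eqB K' finJ' by simp
  have finAB: "finite A" "finite B"
    unfolding A_def B_def using sub fin i finJ' by (auto intro!: finite_UN_I)
  \<comment> \<open>Since \<open>x\<close> and \<open>y\<close> differ, the two punctured copies of
    \<open>F i\<close> together restore \<open>F i\<close>.\<close>
  have un: "A \<union> B = \<Union>(F ` (insert i (J' \<union> K')))"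
    unfolding A_def B_def using xy by auto
  have "card (insert i (J' \<union> K')) \<le> card (A \<union> B)"
    unfolding un by (rule hall) (use sub i in auto)
  then have 1: "Suc (card (J' \<union> K')) \<le> card (A \<union> B)"
    using J' K' finJ' by simp
  have "card (J' \<inter> K') \<le> card (\<Union>(F ` (J' \<inter> K')))"
    by (rule hall) (use sub in auto)
  also have "\<dots> \<le> card (A \<inter> B)"
    by (rule card_mono) (use finAB in \<open>auto simp: A_def B_def\<close>)
  finally have 2: "card (J' \<inter> K') \<le> card (A \<inter> B)" .
  \<comment> \<open>Adding \<open>1\<close> and \<open>2\<close> gives |A| + |B| \<ge> |J'| + |K'| +
    1, whereas \<open>cA\<close> and \<open>cB\<close> give |A| + |B| \<le> |J'| + |K'|.\<close>
  from 1 2 cA cB card_Un_Int[OF finAB] card_Un_Int[OF finJ'] show False by simp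
qed

text \<open>Induction on the total size of the sets. If some \<open>F i\<close> has two elements,
  the preceding lemma shows that one of them can be deleted without losing Hall's condition. Once
  all sets are singletons, Hall's condition on pairs of indices makes them distinct.\<close>

theorem hall_marriage:
  fixes F :: "'i \<Rightarrow> 'b set"
  assumes "finite I" and "\<And>i. i \<in> I \<Longrightarrow> finite (F i)"
    and "\<And>J. J \<subseteq> I \<Longrightarrow> card J \<le> card (\<Union>(F ` J))"
  shows "\<exists>R. inj_on R I \<and> (\<forall>i\<in>I. R i \<in> F i)"
  using assms
proof (induction "\<Sum>i\<in>I. card (F i)" arbitrary: F rule: less_induct)
  case less
  note I = less.prems(1) and fin = less.prems(2) and hall = less.prems(3)
  show ?case
  proof (cases "\<exists>i\<in>I. \<exists>x\<in>F i. \<exists>y\<in>F i. x \<noteq> y")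
    case True
    then obtain i x y where i: "i \<in> I" and xy: "x \<in> F i" "y \<in> F i" "x \<noteq> y" by blast
    have "\<exists>z\<in>F i. \<forall>J\<subseteq>I. card J \<le> card (\<Union>((F(i := F i - {z})) ` J))"
    proof (rule ccontr)
      assume neg: "\<not> ?thesis"
      then obtain J where J: "J \<subseteq> I" "card (\<Union>((F(i := F i - {x})) ` J)) < card J"
        using xy by (meson not_le)
      have "\<forall>K\<subseteq>I. card K \<le> card (\<Union>((F(i := F i - {y})) ` K))"
        using hall_condition_delete_or[where F = F, OF I fin hall i xy(3) J] by blast
      with neg xy(2) show False by blast
    qed
    then obtain z where z: "z \<in> F i" and
      hz: "\<And>J. J \<subseteq> I \<Longrightarrow> card J \<le> card (\<Union>((F(i := F i - {z})) ` J))" by blast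
    let ?F = "F(i := F i - {z})"
    have lt: "(\<Sum>j\<in>I. card (?F j)) < (\<Sum>j\<in>I. card (F j))"
    proof (rule sum_strict_mono_ex1[OF I])
      show "\<forall>j\<in>I. card (?F j) \<le> card (F j)"
        using fin by (auto intro: card_mono)
      show "\<exists>j\<in>I. card (?F j) < card (F j)"
      proof -
        have "card (F i - {z}) < card (F i)"
          using z by (intro psubset_card_mono[OF fin[OF i]]) blast
        then show ?thesis using i by (metis fun_upd_same)
      qed
    qed
    have "\<And>j. j \<in> I \<Longrightarrow> finite (?F j)" using fin by auto
    from less.hyps[OF lt I this hz] obtain R where "inj_on R I" "\<forall>j\<in>I. R j \<in> ?F j" by blast
    then have "inj_on R I \<and> (\<forall>j\<in>I. R j \<in> F j)" by (metis DiffD1 fun_upd_apply)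
    then show ?thesis by blast
  next
    case False
    have "F i \<noteq> {}" if "i \<in> I" for i using hall[of "{i}"] that by auto
    then have "\<forall>i\<in>I. \<exists>r. r \<in> F i" by blast
    then obtain R where R: "\<And>i. i \<in> I \<Longrightarrow> R i \<in> F i" by metis
    have single: "F i = {R i}" if "i \<in> I" for i using that R False by blast
    have "inj_on R I"
    proof (rule inj_onI, rule ccontr)
      fix i j assume ij: "i \<in> I" "j \<in> I" "R i = R j" "i \<noteq> j"
      then show False using hall[of "{i, j}"] single by auto
    qed
    with R show ?thesis by blast
  qed
qed

section \<open>Rayleigh quotients of real symmetric matrices\<close>

lemma inner_symmetric_matrix:
  fixes M :: "real ^ 'n ^ 'n"
  assumes "transpose M = M"
  shows "x \<bullet> (M *v y) = (M *v x) \<bullet> y"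
  by (metis assms dot_lmul_matrix transpose_matrix_vector)

text \<open>Eigenvectors for distinct eigenvalues are orthogonal, hence independent. Finiteness is
  what gives the \<open>Max\<close> in \<open>largest_eigenvalue\<close> its meaning.\<close>

lemma finite_eigenvalues:
  fixes M :: "real ^ 'n ^ 'n"
  assumes sym: "transpose M = M"
  shows "finite (eigenvalues M)"
proof -
  have "\<forall>l\<in>eigenvalues M. \<exists>x. x \<noteq> 0 \<and> M *v x = l *\<^sub>R x"
    by (simp add: eigenvalues_def)
  then obtain v where v: "\<And>l. l \<in> eigenvalues M \<Longrightarrow> v l \<noteq> 0 \<and> M *v v l = l *\<^sub>R v l"
    by metis
  have orth: "v l \<bullet> v k = 0" if "l \<in> eigenvalues M" "k \<in> eigenvalues M" "l \<noteq> k" for l k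
    using inner_symmetric_matrix[OF sym, of "v l" "v k"] v that by auto
  have "inj_on v (eigenvalues M)"
    by (rule inj_onI) (metis inner_eq_zero_iff orth v)
  moreover have "independent (v ` eigenvalues M)"
    by (rule pairwise_orthogonal_independent)
      (use orth v in \<open>auto simp: pairwise_def orthogonal_def\<close>)
  ultimately show ?thesis
    using independent_imp_finite finite_imageD by blast
qed

text \<open>By compactness the quadratic form attains its maximum \<open>m\<close> on the unit
  sphere, and a maximiser is an eigenvector for \<open>m\<close>.\<close>

lemma rayleigh_le_largest_eigenvalue:
  fixes M :: "real ^ 'n ^ 'n"
  assumes sym: "transpose M = M"
  shows "x \<bullet> (M *v x) \<le> largest_eigenvalue M * (x \<bullet> x)"
proof -
  have "sphere (0 :: real ^ 'n) 1 \<noteq> {}"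
    using norm_axis_1 by (metis dist_0_norm empty_iff mem_sphere)
  moreover have "continuous_on (sphere 0 1) (\<lambda>y. y \<bullet> (M *v y))"
    by (intro continuous_intros matrix_vector_mult_linear_continuous_on)
  ultimately have "\<exists>z\<in>sphere 0 1. \<forall>y\<in>sphere 0 1. y \<bullet> (M *v y) \<le> z \<bullet> (M *v z)"
    by (intro continuous_attains_sup compact_sphere)
  then obtain z where z: "z \<in> sphere 0 1"
    and zmax: "\<And>y. y \<in> sphere 0 1 \<Longrightarrow> y \<bullet> (M *v y) \<le> z \<bullet> (M *v z)"
    by blast
  define m where "m = z \<bullet> (M *v z)"
  have zz: "z \<bullet> z = 1" using z by (simp add: dot_square_norm)
  have bound: "y \<bullet> (M *v y) \<le> m * (y \<bullet> y)" for y
  proof (cases "y = 0")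
    case False
    have "(y /\<^sub>R norm y) \<bullet> (M *v (y /\<^sub>R norm y)) \<le> m"
      unfolding m_def using False by (intro zmax) simp
    then have "(y \<bullet> (M *v y)) / (norm y)\<^sup>2 \<le> m"
      by (simp add: matrix_vector_mult_scaleR power2_eq_square divide_inverse ac_simps)
    then show ?thesis
      using False by (simp add: pos_divide_le_eq dot_square_norm)
  qed simp
  define y where "y = m *\<^sub>R z - M *v z"
  define d where "d = m * (y \<bullet> y) - y \<bullet> (M *v y)"
  have d: "0 \<le> d" using bound[of y] by (simp add: d_def)
  \<comment> \<open>the quadratic form of \<open>m - M\<close> is nonnegative and vanishes at \<open>z\<close>, so \<open>m *\<^sub>R z - M *v z = 0\<close>\<close>
  have quad: "0 \<le> 2 * t * (y \<bullet> y) + t\<^sup>2 * d" for t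
  proof -
    have sy: "z \<bullet> (M *v y) = y \<bullet> (M *v z)"
      using inner_symmetric_matrix[OF sym, of z y] by (simp add: inner_commute)
    have yy: "y \<bullet> y = m * (z \<bullet> y) - y \<bullet> (M *v z)"
      by (subst (2) y_def) (simp add: inner_diff_right inner_commute)
    have "(z + t *\<^sub>R y) \<bullet> (z + t *\<^sub>R y) = 1 + 2 * t * (z \<bullet> y) + t\<^sup>2 * (y \<bullet> y)"
      by (simp add: zz inner_add_left inner_add_right inner_commute[of y z] power2_eq_square
          algebra_simps)
    moreover have "(z + t *\<^sub>R y) \<bullet> (M *v (z + t *\<^sub>R y))
        = m + 2 * t * (y \<bullet> (M *v z)) + t\<^sup>2 * (y \<bullet> (M *v y))"
      by (simp add: sy m_def matrix_vector_right_distrib matrix_vector_mult_scaleR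
          inner_add_left inner_add_right power2_eq_square algebra_simps)
    ultimately have "m * (1 + 2 * t * (z \<bullet> y) + t\<^sup>2 * (y \<bullet> y))
        - (m + 2 * t * (y \<bullet> (M *v z)) + t\<^sup>2 * (y \<bullet> (M *v y))) \<ge> 0"
      using bound[of "z + t *\<^sub>R y"] by simp
    then show ?thesis unfolding yy d_def by (simp add: algebra_simps)
  qed
  have "y \<bullet> y = 0"
  proof (rule ccontr)
    assume "y \<bullet> y \<noteq> 0"
    then have c: "0 < y \<bullet> y" by simp
    define c where "c = y \<bullet> y"
    \<comment> \<open>Minimising the quadratic in \<open>quad\<close> would take t = -c / d; using d
      + 1 instead covers d = 0 and still makes the value negative.\<close>
    define e where "e = d + 1"
    have e: "0 < e" "d = e - 1" using d by (auto simp: e_def)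
    have "2 * (- c / e) * c + (- c / e)\<^sup>2 * d = - (c\<^sup>2 / e) - (c / e)\<^sup>2"
      using e(1) unfolding e(2) by (simp add: field_simps power2_eq_square)
    also have "\<dots> < 0"
    proof -
      have "0 < c\<^sup>2 / e" using c e(1) by (simp add: c_def)
      then show ?thesis by (smt (verit) zero_le_power2)
    qed
    finally show False using quad[of "- c / e"] by (simp add: c_def)
  qed
  then have "M *v z = m *\<^sub>R z" by (simp add: y_def)
  moreover have "z \<noteq> 0" using zz by auto
  ultimately have "m \<in> eigenvalues M" unfolding eigenvalues_def by blast
  then have "m \<le> largest_eigenvalue M"
    unfolding largest_eigenvalue_def using finite_eigenvalues[OF sym] by (rule Max_ge[rotated])
  then show ?thesis using bound[of x] by (meson inner_ge_zero mult_right_mono order_trans)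
qed

section \<open>Fractional perfect matchings and violations of Hall's condition\<close>

lemma card_eq_sum_card_fibres:
  fixes g :: "'v::finite \<Rightarrow> 'b"
  assumes "finite E"
  shows "(\<Sum>e\<in>E. card {v. g v = e}) = card {v. g v \<in> E}"
proof -
  have "{v. g v \<in> E} = (\<Union>e\<in>E. {v. g v = e})" by auto
  then show ?thesis using assms by (simp add: card_UN_disjoint disjoint_iff)
qed

lemma pair_graph_arc_sym:
  assumes "pair_graph G" "(u, v) \<in> parcs G"
  shows "(v, u) \<in> parcs G"
proof -
  interpret pair_graph G by fact
  show ?thesis using assms(2) by (rule arcs_symmetric)
qed

lemma vertex_degree_eq_card_arcs:
  assumes "pair_graph G"
  shows "vertex_degree G u = card {v. (u, v) \<in> parcs G}"
proof -
  have "incident_edges G u = (\<lambda>v. {u, v}) ` {v. (u, v) \<in> parcs G}"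
    unfolding incident_edges_def edges_def using pair_graph_arc_sym[OF assms]
    by (auto simp: image_iff doubleton_eq_iff)
  moreover have "inj_on (\<lambda>v. {u, v}) {v. (u, v) \<in> parcs G}"
    by (auto simp: inj_on_def doubleton_eq_iff)
  ultimately show ?thesis by (simp add: vertex_degree_def card_image)
qed

text \<open>\<open>R\<close> is the perfect matching of the double cover: an edge gets 1/2 for each
  of its ends that selects it, so 1 if both do. A vertex \<open>v\<close> meets its own selected
  edge and, by injectivity, at most one selected by another vertex. The n selections have total
  weight n/2.\<close>

lemma fractional_perfect_matching_of_inj:
  fixes G :: "'v::finite pair_pre_digraph"
  assumes "pverts G = UNIV" and R: "inj R" and arc: "\<And>v. (v, R v) \<in> parcs G"
  shows "fractional_perfect_matching G (\<lambda>e. real (card {v. {v, R v} = e}) / 2)"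
proof -
  have total: "(\<Sum>e\<in>E. real (card {v. {v, R v} = e}) / 2) = real (card {v. {v, R v} \<in> E}) / 2"
    for E
    by (simp flip: sum_divide_distrib of_nat_sum add: card_eq_sum_card_fibres)
  have at_most_one: "real (card {w. {w, R w} = e}) / 2 \<le> 1" if edge: "e \<in> edges G" for e
  proof -
    obtain u v where e: "e = {u, v}" using edge unfolding edges_def by blast
    have "card {w. {w, R w} = e} \<le> card {u, v}"
      by (rule card_mono) (auto simp: e)
    also have "\<dots> \<le> 2" by (simp add: card_insert_if)
    finally show ?thesis by simp
  qed
  have vertex: "(\<Sum>e\<in>incident_edges G v. real (card {w. {w, R w} = e}) / 2) \<le> 1" for v
  proof -
    have "{w. {w, R w} \<in> incident_edges G v} \<subseteq> insert v {w. R w = v}"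
      by (auto simp: incident_edges_def)
    then have "card {w. {w, R w} \<in> incident_edges G v} \<le> card (insert v {w. R w = v})"
      by (intro card_mono) auto
    also have "\<dots> \<le> Suc (card {w. R w = v})" by (simp add: card_insert_if)
    also have "card {w. R w = v} \<le> 1"
      using R by (auto simp: card_le_Suc0_iff_eq inj_def)
    finally show ?thesis unfolding total by simp
  qed
  have "{v. {v, R v} \<in> edges G} = UNIV" using arc by (auto simp: edges_def)
  then have "(\<Sum>e\<in>edges G. real (card {v. {v, R v} = e}) / 2) = real (card (pverts G)) / 2"
    unfolding total using assms(1) by simp
  with at_most_one vertex show ?thesis
    by (simp add: fractional_perfect_matching_def fractional_matching_def)
qed

text \<open>Hall's theorem for the neighbourhoods yields a violating \<open>X\<close>. Discarding
  the common part of \<open>X\<close> and its neighbourhood costs both sides equally, so the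
  deficiency survives.\<close>

lemma independent_set_if_no_fractional_perfect_matching:
  fixes G :: "'v::finite pair_pre_digraph"
  assumes G: "pair_graph G" "pverts G = UNIV"
    and none: "\<not> (\<exists>f. fractional_perfect_matching G f)"
  obtains T where "T \<inter> parcs G `` T = {}" "card (parcs G `` T) < card T"
proof -
  let ?N = "\<lambda>X. parcs G `` X"
  have "\<exists>X. card (?N X) < card X"
  proof (rule ccontr)
    assume "\<not> ?thesis"
    moreover have "\<Union>((\<lambda>v. ?N {v}) ` X) = ?N X" for X by auto
    ultimately have "\<And>X. X \<subseteq> UNIV \<Longrightarrow> card X \<le> card (\<Union>((\<lambda>v. ?N {v}) ` X))"
      by (simp add: not_less)
    from hall_marriage[of UNIV "\<lambda>v. ?N {v}", OF _ _ this]
    obtain R where "inj R" "\<And>v. (v, R v) \<in> parcs G" by auto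
    with none fractional_perfect_matching_of_inj[OF G(2)] show False by blast
  qed
  then obtain X where X: "card (?N X) < card X" by blast
  define T where "T = X - ?N X"
  \<comment> \<open>If a neighbour of some \<open>v\<close> in \<open>T\<close> lay in
    \<open>X\<close>, then \<open>v\<close> itself would be a neighbour of \<open>X\<close> by
    symmetry.\<close>
  have sub: "?N T \<subseteq> ?N X - X"
    using pair_graph_arc_sym[OF G(1)] by (auto simp: T_def)
  have "card (?N T) \<le> card (?N X - X)" using sub by (intro card_mono) auto
  moreover have "card (?N X - X) + card (X \<inter> ?N X) = card (?N X)"
    using card_Diff_subset_Int[of "?N X" X] card_mono[of "?N X" "?N X \<inter> X"] by (simp add: Int_commute)
  moreover have "card T + card (X \<inter> ?N X) = card X"
    unfolding T_def using card_Diff_subset_Int[of X "?N X"] card_mono[of X "X \<inter> ?N X"] by simp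
  ultimately have "card (?N T) < card T" using X by linarith
  moreover have "T \<inter> ?N T = {}" using sub by (auto simp: T_def)
  ultimately show thesis using that by blast
qed

section \<open>An eigenvalue bound from an independent set and its neighbours\<close>

text \<open>The degree term at \<open>u\<close> is spread over the arcs leaving \<open>u\<close>.
  The two orientations of an edge together carry both squares and twice the product.\<close>

lemma quadratic_form_eq_sum_arcs:
  fixes G :: "'v::finite pair_pre_digraph" and x :: "real ^ 'v"
  assumes G: "pair_graph G"
  shows "x \<bullet> ((a *\<^sub>R degree_matrix G + adjacency_matrix G) *v x)
    = (\<Sum>(u, v)\<in>parcs G. a * (x $ u)\<^sup>2 + x $ u * x $ v)"
proof -
  let ?N = "\<lambda>u. {v. (u, v) \<in> parcs G}"
  have row: "((a *\<^sub>R degree_matrix G + adjacency_matrix G) *v x) $ u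
      = a * real (card (?N u)) * x $ u + (\<Sum>v\<in>?N u. x $ v)" for u
  proof -
    have "((a *\<^sub>R degree_matrix G + adjacency_matrix G) *v x) $ u
      = (\<Sum>v\<in>UNIV. (if u = v then a * real (vertex_degree G u) * x $ v else 0)
          + (if (u, v) \<in> parcs G then x $ v else 0))"
      unfolding matrix_vector_mult_def degree_matrix_def adjacency_matrix_def
      by (auto intro!: sum.cong simp: algebra_simps)
    also have "\<dots> = a * real (vertex_degree G u) * x $ u + (\<Sum>v\<in>?N u. x $ v)"
      by (simp add: sum.distrib sum.If_cases)
    finally show ?thesis by (simp add: vertex_degree_eq_card_arcs[OF G])
  qed
  have "x \<bullet> ((a *\<^sub>R degree_matrix G + adjacency_matrix G) *v x)
      = (\<Sum>u\<in>UNIV. \<Sum>v\<in>?N u. a * (x $ u)\<^sup>2 + x $ u * x $ v)"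
    unfolding inner_vec_def row
    by (simp add: sum.distrib sum_distrib_left power2_eq_square algebra_simps)
  also have "\<dots> = (\<Sum>(u, v)\<in>Sigma UNIV ?N. a * (x $ u)\<^sup>2 + x $ u * x $ v)"
    by (rule sum.Sigma) auto
  also have "Sigma UNIV ?N = parcs G" by auto
  finally show ?thesis .
qed

lemma transpose_degree_adjacency_matrix:
  assumes "pair_graph G"
  shows "transpose (a *\<^sub>R degree_matrix G + adjacency_matrix G)
    = a *\<^sub>R degree_matrix G + adjacency_matrix G"
  using pair_graph_arc_sym[OF assms]
  by (auto simp: vec_eq_iff transpose_def degree_matrix_def adjacency_matrix_def)

text \<open>All summands of the quadratic form are nonnegative, so it suffices to keep the edges
  between \<open>T\<close> and its neighbourhood, in both orientations. Every edge at a vertex of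
  \<open>T\<close> is of this kind, and no edge is counted from two vertices of
  \<open>T\<close>.\<close>

lemma largest_eigenvalue_ge_two_valued_vector:
  fixes G :: "'v::finite pair_pre_digraph"
  assumes G: "pair_graph G" "pverts G = UNIV"
    and indep: "T \<inter> parcs G `` T = {}"
    and nonneg: "0 \<le> a" "0 \<le> \<alpha>" "0 \<le> \<beta>"
  shows "real (min_degree G) * real (card T) * (a * (\<alpha>\<^sup>2 + \<beta>\<^sup>2) + 2 * \<alpha> * \<beta>)
    \<le> largest_eigenvalue (a *\<^sub>R degree_matrix G + adjacency_matrix G)
        * (real (card (parcs G `` T)) * \<alpha>\<^sup>2 + real (card T) * \<beta>\<^sup>2)"
proof -
  let ?S = "parcs G `` T"
  let ?M = "a *\<^sub>R degree_matrix G + adjacency_matrix G"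
  define x :: "real ^ 'v" where "x = (\<chi> w. if w \<in> T then \<beta> else if w \<in> ?S then \<alpha> else 0)"
  let ?h = "\<lambda>(u, v). a * (x $ u)\<^sup>2 + x $ u * x $ v"
  define P where "P = (SIGMA u:T. {v. (u, v) \<in> parcs G})"
  have xT: "x $ w = \<beta>" if "w \<in> T" for w using that by (simp add: x_def)
  have xS: "x $ w = \<alpha>" if "w \<in> ?S" for w using that indep by (auto simp: x_def)
  have x0: "0 \<le> x $ w" for w using nonneg by (simp add: x_def)
  have P: "u \<in> T" "v \<in> ?S" "(u, v) \<in> parcs G" if "(u, v) \<in> P" for u v
    using that by (auto simp: P_def)
  have disj: "P \<inter> prod.swap ` P = {}" using P(1,2) indep by fastforce
  have sub: "P \<union> prod.swap ` P \<subseteq> parcs G"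
    using P(3) pair_graph_arc_sym[OF G(1)] by auto
  have "real (min_degree G) * real (card T) \<le> real (card P)"
  proof -
    have "min_degree G \<le> card {v. (u, v) \<in> parcs G}" for u
      using G(2) unfolding min_degree_def vertex_degree_eq_card_arcs[OF G(1), symmetric]
      by (intro Min_le) auto
    then have "(\<Sum>u\<in>T. min_degree G) \<le> (\<Sum>u\<in>T. card {v. (u, v) \<in> parcs G})"
      by (intro sum_mono)
    also have "\<dots> = card P" by (simp add: P_def)
    finally have "(\<Sum>u\<in>T. min_degree G) \<le> card P" .
    then show ?thesis by (simp add: mult.commute flip: of_nat_mult)
  qed
  then have "real (min_degree G) * real (card T) * (a * (\<alpha>\<^sup>2 + \<beta>\<^sup>2) + 2 * \<alpha> * \<beta>)
      \<le> real (card P) * (a * (\<alpha>\<^sup>2 + \<beta>\<^sup>2) + 2 * \<alpha> * \<beta>)"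
    using nonneg by (intro mult_right_mono) auto
  also have "\<dots> = (\<Sum>p\<in>P. a * \<beta>\<^sup>2 + \<beta> * \<alpha>) + (\<Sum>p\<in>P. a * \<alpha>\<^sup>2 + \<alpha> * \<beta>)"
    by (simp add: algebra_simps)
  also have "(\<Sum>p\<in>P. a * \<beta>\<^sup>2 + \<beta> * \<alpha>) = sum ?h P"
    by (rule sum.cong) (use P xT xS in auto)
  also have "(\<Sum>p\<in>P. a * \<alpha>\<^sup>2 + \<alpha> * \<beta>) = sum (?h \<circ> prod.swap) P"
    by (rule sum.cong) (use P xT xS in auto)
  also have "\<dots> = sum ?h (prod.swap ` P)"
    by (rule sum.reindex[symmetric]) simp
  also have "sum ?h P + sum ?h (prod.swap ` P) = sum ?h (P \<union> prod.swap ` P)"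
    using disj by (intro sum.union_disjoint[symmetric]) auto
  also have "\<dots> \<le> sum ?h (parcs G)"
    using sub nonneg x0 by (intro sum_mono2) auto
  also have "\<dots> = x \<bullet> (?M *v x)" by (rule quadratic_form_eq_sum_arcs[OF G(1), symmetric])
  also have "\<dots> \<le> largest_eigenvalue ?M * (x \<bullet> x)"
    by (rule rayleigh_le_largest_eigenvalue[OF transpose_degree_adjacency_matrix[OF G(1)]])
  also have "x \<bullet> x = (\<Sum>w\<in>T \<union> ?S. x $ w * x $ w)"
    unfolding inner_vec_def by (rule sum.mono_neutral_cong_right) (auto simp: x_def)
  also have "\<dots> = (\<Sum>w\<in>T. x $ w * x $ w) + (\<Sum>w\<in>?S. x $ w * x $ w)"
    using indep by (intro sum.union_disjoint) auto
  also have "\<dots> = real (card ?S) * \<alpha>\<^sup>2 + real (card T) * \<beta>\<^sup>2"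
    by (simp add: xT xS power2_eq_square)
  finally show ?thesis .
qed

section \<open>Comparison of the bound with \<open>phi\<close>\<close>

text \<open>
  The weights \<open>1 / sqrt s\<close>, \<open>1 / sqrt t\<close> are optimal for \<open>a = 0\<close> and \<open>1 / s\<close>, \<open>1 / t\<close> for
  \<open>a = 1\<close>; the latter also serve for \<open>a \<le> 1\<close>, where \<open>2 \<alpha> \<beta> \<ge> 2 a \<alpha> \<beta>\<close>. For \<open>a > 1\<close> the
  indicator vector of the side of size \<open>s\<close> suffices.
\<close>

lemma phi_le_of_two_valued_bounds:
  fixes s t :: real
  assumes s: "1 \<le> s" "s + 1 \<le> t" "s + t \<le> real n" and a: "0 \<le> a"
    and bound: "\<And>\<alpha> \<beta>. 0 \<le> \<alpha> \<Longrightarrow> 0 \<le> \<beta> \<Longrightarrow>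
      real d * t * (a * (\<alpha>\<^sup>2 + \<beta>\<^sup>2) + 2 * \<alpha> * \<beta>) \<le> l * (s * \<alpha>\<^sup>2 + t * \<beta>\<^sup>2)"
  shows "phi a n (int d) 1 \<le> l"
proof -
  have pos: "0 < s" "0 < t" "0 < real n - 1" using s by auto
  \<comment> \<open>Used through t(n - 1) - s(n + 1) = n(t - s) - (s + t) \<ge> n(t - s -
    1).\<close>
  have "0 \<le> real n * (t - s - 1)" using s by simp
  then have "s * (real n + 1) \<le> t * (real n - 1)" using s by (simp add: algebra_simps)
  then have ratio: "(real n + 1) / (real n - 1) \<le> t / s"
    using pos by (simp add: divide_le_eq le_divide_eq mult.commute)
  consider "a = 0" | "0 < a" "a \<le> 1" | "1 < a" using a by linarith
  then show ?thesis
  proof cases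
    case 1
    have "1 + 2 / (real n - 1) = (real n + 1) / (real n - 1)" using pos by (simp add: field_simps)
    then have "phi a n (int d) 1 = real d * sqrt ((real n + 1) / (real n - 1))"
      using 1 by (simp add: phi_def)
    also have "\<dots> \<le> real d * sqrt (t / s)"
      using ratio by (intro mult_left_mono) auto
    also have "sqrt (t / s) = t * (1 / sqrt s) * (1 / sqrt t)"
    proof -
      have "t * (1 / sqrt s) * (1 / sqrt t) = (t / sqrt t) / sqrt s" by simp
      then show ?thesis using pos by (simp only: real_div_sqrt real_sqrt_divide less_imp_le)
    qed
    also have "real d * (t * (1 / sqrt s) * (1 / sqrt t)) \<le> l"
    proof -
      define p q where "p = 1 / sqrt s" and "q = 1 / sqrt t"
      have "s * p\<^sup>2 + t * q\<^sup>2 = 2" "0 \<le> p" "0 \<le> q"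
        using pos by (simp_all add: p_def q_def power_divide)
      then have "2 * (real d * (t * p * q)) \<le> 2 * l"
        using bound[of p q] 1 by (simp add: algebra_simps)
      then show ?thesis by (simp add: p_def q_def)
    qed
    finally show ?thesis .
  next
    case 2
    define w where "w = 1 / s + 1 / t"
    have w: "0 < w" using pos by (simp add: w_def add_pos_pos)
    \<comment> \<open>Lowering the coefficient of the mixed term to \<open>a\<close> leaves a
      perfect square; the squared norm for these weights is \<open>w\<close> as well, so one factor
      \<open>w\<close> cancels.\<close>
    have "a * w\<^sup>2 = a * ((1 / s)\<^sup>2 + (1 / t)\<^sup>2) + a * (2 * (1 / s) * (1 / t))"
      unfolding w_def power2_sum distrib_left ..
    also have "a * (2 * (1 / s) * (1 / t)) \<le> 1 * (2 * (1 / s) * (1 / t))"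
      using 2 pos by (intro mult_right_mono) auto
    finally have "a * w\<^sup>2 \<le> a * ((1 / s)\<^sup>2 + (1 / t)\<^sup>2) + 2 * (1 / s) * (1 / t)"
      by simp
    then have "real d * t * (a * w\<^sup>2)
        \<le> real d * t * (a * ((1 / s)\<^sup>2 + (1 / t)\<^sup>2) + 2 * (1 / s) * (1 / t))"
      using pos by (intro mult_left_mono) auto
    also have "\<dots> \<le> l * (s * (1 / s)\<^sup>2 + t * (1 / t)\<^sup>2)"
      using pos by (intro bound) auto
    also have "s * (1 / s)\<^sup>2 + t * (1 / t)\<^sup>2 = w"
      using pos by (simp add: w_def power2_eq_square)
    finally have "(a * real d * (t * w)) * w \<le> l * w"
      by (simp add: power2_eq_square algebra_simps)
    then have *: "a * real d * (t * w) \<le> l" using w by (rule mult_right_le_imp_le)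
    have "2 * real n / (real n - 1) = 1 + (real n + 1) / (real n - 1)"
      using pos by (simp add: field_simps)
    also have "\<dots> \<le> 1 + t / s" using ratio by simp
    also have "1 + t / s = t * w" using pos by (simp add: w_def field_simps)
    finally have "a * real d * (2 * real n / (real n - 1)) \<le> a * real d * (t * w)"
      using 2 by (intro mult_left_mono) auto
    moreover have "phi a n (int d) 1 = a * real d * (2 * real n / (real n - 1))"
      using 2 by (simp add: phi_def)
    ultimately show ?thesis using * by simp
  next
    case 3
    have "phi a n (int d) 1 = a * real d * ((real n + 1) / (real n - 1))"
      using 3 by (simp add: phi_def)
    also have "\<dots> \<le> a * real d * (t / s)" using ratio 3 by (intro mult_left_mono) auto
    also have "\<dots> \<le> l" using bound[of 1 0] pos by (simp add: divide_le_eq algebra_simps)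
    finally show ?thesis .
  qed
qed

theorem corollary4p4:
  fixes a :: real and n :: nat and G :: "'v::finite pair_pre_digraph"
  assumes "a \<ge> 0"
    and "pair_graph G"
    and "pverts G = UNIV"
    and "Digraph_Component.connected (with_proj G)"
    and "n = card (pverts G)"
    and "n \<ge> 2"
    and "real (min_degree G) \<le> (real n - 1) / 2"
    and "largest_eigenvalue (a *\<^sub>R degree_matrix G + adjacency_matrix G)
           < phi a n (int (min_degree G)) 1"
  shows "\<exists>f. fractional_perfect_matching G f"
proof (rule ccontr)
  assume "\<not> ?thesis"
  then obtain T where T: "T \<inter> parcs G `` T = {}" "card (parcs G `` T) < card T"
    by (rule independent_set_if_no_fractional_perfect_matching[OF assms(2,3)])
  let ?l = "largest_eigenvalue (a *\<^sub>R degree_matrix G + adjacency_matrix G)"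
  note bound = largest_eigenvalue_ge_two_valued_vector[OF assms(2,3) T(1) assms(1)]
  have "phi a n (int (min_degree G)) 1 \<le> ?l"
  proof (cases "parcs G `` T = {}")
    case True
    \<comment> \<open>The ratio t / s is undefined here, but \<open>T\<close> contains an isolated
      vertex, so \<open>phi\<close> vanishes; the indicator vector of \<open>T\<close> shows that
      \<open>?l\<close> is nonnegative.\<close>
    obtain u where "u \<in> T" using T(2) by fastforce
    then have "vertex_degree G u = 0"
      using True by (auto simp: vertex_degree_eq_card_arcs[OF assms(2)])
    moreover have "min_degree G \<le> vertex_degree G u"
      unfolding min_degree_def using assms(3) by (intro Min_le) auto
    ultimately have "phi a n (int (min_degree G)) 1 = 0" by (simp add: phi_def)
    moreover have "0 \<le> ?l * real (card T)"
      using bound[of 0 1] assms(1) by (simp add: order_trans[rotated])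
    ultimately show ?thesis using T(2) by (auto simp: zero_le_mult_iff)
  next
    case False
    have "card (parcs G `` T) + card T = card (parcs G `` T \<union> T)"
      using T(1) by (intro card_Un_disjoint[symmetric]) auto
    also have "\<dots> \<le> n" unfolding assms(3,5) by (intro card_mono) auto
    finally have "real (card (parcs G `` T)) + real (card T) \<le> real n"
      by (metis of_nat_add of_nat_le_iff)
    moreover have "1 \<le> real (card (parcs G `` T))"
      using False by (simp add: Suc_le_eq card_gt_0_iff)
    moreover have "real (card (parcs G `` T)) + 1 \<le> real (card T)" using T(2) by simp
    ultimately show ?thesis using assms(1) bound by (intro phi_le_of_two_valued_bounds) auto
  qed
  with assms(8) show False by simp
qed

end
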